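(* Let $\mathrm{Nil}$ be the three dimensional Heisenberg group and $\mathbb{B}_0=(X,Y,Z)$ the basis of its Lie algebra whose only non-vanishing bracket (up to antisymmetry) is $[X,Y]=Z$. (1) For $\lambda>0$, the left invariant metric with matrix $\mathrm{diag}(1,1,-\lambda)$ in $\mathbb{B}_0$ has Ricci curvature and scalar curvature $$M(\mathrm{ric},\mathbb{B}_0)=\frac12\begin{pmatrix}\lambda&0&0\\0&\lambda&0\\0&0&\lambda^2\end{pmatrix},\qquad \mathfrak{s}=\frac12\lambda.$$ In particular $\mathrm{ric}>0$ (positive definite) and $\mathfrak{s}>0$. (2) For $\lambda>0$, the left invariant metric with matrix $\mathrm{diag}(\lambda,1,-1)$ in $\mathbb{B}_0$ has Ricci curvature and scalar curvature $$M(\mathrm{ric},\mathbb{B}_0)=\frac12\begin{pmatrix}1&0&0\\0&\frac1\lambda&0\\0&0&\frac1\lambda\end{pmatrix},\qquad \mathfrak{s}=\frac1{2\lambda}.$$ In particular $\mathrm{ric}>0$ and $\mathfrak{s}>0$. (3) The left invariant metric with matrix $\begin{pmatrix}1&0&0\\0&1&\frac12\\0&\frac12&0\end{pmatrix}$ in $\mathbb{B}_0$ is flat.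
   Context: A left invariant metric on a Lie group with Lie algebra $\mathfrak{g}$ is identified with a nondegenerate symmetric bilinear form $\langle\,,\rangle$ on $\mathfrak{g}$. The Levi-Civita product $\mathrm{L}:\mathfrak{g}\times\mathfrak{g}\to\mathfrak{g}$ is given by $2\langle\mathrm{L}_uv,w\rangle=\langle[u,v],w\rangle+\langle[w,u],v\rangle+\langle[w,v],u\rangle$, the curvature by $\mathrm{K}(u,v)=\mathrm{L}_{[u,v]}-[\mathrm{L}_u,\mathrm{L}_v]$, the Ricci tensor by $\mathrm{ric}(u,v)=\mathrm{tr}(w\mapsto\mathrm{K}(u,w)v)$, the Ricci operator by $\langle\mathrm{Ric}(u),v\rangle=\mathrm{ric}(u,v)$, and the scalar curvature by $\mathfrak{s}=\mathrm{tr}(\mathrm{Ric})$. $M(\mathrm{ric},\mathbb{B}_0)$ is the Gram matrix of $\mathrm{ric}$ in $\mathbb{B}_0$. The metric is flat if $\mathrm{K}=0$. *)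

theory Defs
  imports "HOL-Analysis.Analysis"
begin

text \<open>
  A Lie algebra is given by a linear subspace \<open>g\<close> of an ambient real vector space together with
  its bracket \<open>br\<close>; forms and operators are total functions of which only the values on \<open>g\<close> matter.
\<close>

definition ordered_basis :: "'a::real_vector set \<Rightarrow> 'a ^ 'n \<Rightarrow> bool" where
  "ordered_basis g B \<longleftrightarrow>
     inj (($) B) \<and> independent (range (($) B)) \<and> span (range (($) B)) = g"

definition gram_matrix :: "('a \<Rightarrow> 'a \<Rightarrow> real) \<Rightarrow> 'a ^ 'n \<Rightarrow> real ^ 'n ^ 'n" where
  "gram_matrix b B = (\<chi> i j. b (B $ i) (B $ j))"

text \<open>
  Intended for finite-dimensional \<open>V\<close> and \<open>f\<close> linear from \<open>V\<close> to \<open>V\<close>; the value then does not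
  depend on the chosen basis.
\<close>

definition trace_on :: "'a::real_vector set \<Rightarrow> ('a \<Rightarrow> 'a) \<Rightarrow> real" where
  "trace_on V f =
     (let B = (SOME B. independent B \<and> span B = V) in \<Sum>b\<in>B. representation B (f b) b)"

text \<open>
  A left invariant metric on a Lie group, identified with its value at the neutral element; any
  signature is allowed.
\<close>

definition left_inv_metric :: "'a::real_vector set \<Rightarrow> ('a \<Rightarrow> 'a \<Rightarrow> real) \<Rightarrow> bool" where
  "left_inv_metric g ip \<longleftrightarrow>
     (\<forall>u\<in>g. \<forall>v\<in>g. \<forall>w\<in>g. \<forall>a b. ip (a *\<^sub>R u + b *\<^sub>R v) w = a * ip u w + b * ip v w) \<and>
     (\<forall>u\<in>g. \<forall>v\<in>g. ip u v = ip v u) \<and>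
     (\<forall>u\<in>g. (\<forall>v\<in>g. ip u v = 0) \<longrightarrow> u = 0)"

text \<open>The element \<open>L\<^sub>u v\<close> exists and is unique because the metric is nondegenerate.\<close>

definition levi_civita ::
  "'a::real_vector set \<Rightarrow> ('a \<Rightarrow> 'a \<Rightarrow> 'a) \<Rightarrow> ('a \<Rightarrow> 'a \<Rightarrow> real) \<Rightarrow> 'a \<Rightarrow> 'a \<Rightarrow> 'a" where
  "levi_civita g br ip u v =
     (THE x. x \<in> g \<and>
        (\<forall>w\<in>g. 2 * ip x w = ip (br u v) w + ip (br w u) v + ip (br w v) u))"

definition curvature ::
  "'a::real_vector set \<Rightarrow> ('a \<Rightarrow> 'a \<Rightarrow> 'a) \<Rightarrow> ('a \<Rightarrow> 'a \<Rightarrow> real) \<Rightarrow> 'a \<Rightarrow> 'a \<Rightarrow> 'a \<Rightarrow> 'a" where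
  "curvature g br ip u v w =
     (let L = levi_civita g br ip in L (br u v) w - (L u (L v w) - L v (L u w)))"

definition ric ::
  "'a::real_vector set \<Rightarrow> ('a \<Rightarrow> 'a \<Rightarrow> 'a) \<Rightarrow> ('a \<Rightarrow> 'a \<Rightarrow> real) \<Rightarrow> 'a \<Rightarrow> 'a \<Rightarrow> real" where
  "ric g br ip u v = trace_on g (\<lambda>w. curvature g br ip u w v)"

definition ricci_operator ::
  "'a::real_vector set \<Rightarrow> ('a \<Rightarrow> 'a \<Rightarrow> 'a) \<Rightarrow> ('a \<Rightarrow> 'a \<Rightarrow> real) \<Rightarrow> 'a \<Rightarrow> 'a" where
  "ricci_operator g br ip u = (THE x. x \<in> g \<and> (\<forall>v\<in>g. ip x v = ric g br ip u v))"

definition scalar_curvature ::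
  "'a::real_vector set \<Rightarrow> ('a \<Rightarrow> 'a \<Rightarrow> 'a) \<Rightarrow> ('a \<Rightarrow> 'a \<Rightarrow> real) \<Rightarrow> real" where
  "scalar_curvature g br ip = trace_on g (ricci_operator g br ip)"

definition flat ::
  "'a::real_vector set \<Rightarrow> ('a \<Rightarrow> 'a \<Rightarrow> 'a) \<Rightarrow> ('a \<Rightarrow> 'a \<Rightarrow> real) \<Rightarrow> bool" where
  "flat g br ip \<longleftrightarrow> (\<forall>u\<in>g. \<forall>v\<in>g. \<forall>w\<in>g. curvature g br ip u v w = 0)"

definition positive_definite_on :: "'a::real_vector set \<Rightarrow> ('a \<Rightarrow> 'a \<Rightarrow> real) \<Rightarrow> bool" where
  "positive_definite_on g b \<longleftrightarrow> (\<forall>u\<in>g. u \<noteq> 0 \<longrightarrow> b u u > 0)"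

text \<open>The Lie algebra of a matrix Lie group: its tangent space at the identity.\<close>

definition tangent_at_id :: "(real ^ 'n ^ 'n) set \<Rightarrow> (real ^ 'n ^ 'n) set" where
  "tangent_at_id G =
     {A. \<exists>\<gamma>. (\<forall>t. \<gamma> t \<in> G) \<and> \<gamma> 0 = mat 1 \<and> (\<gamma> has_vector_derivative A) (at (0::real))}"

definition commutator :: "real ^ 'n ^ 'n \<Rightarrow> real ^ 'n ^ 'n \<Rightarrow> real ^ 'n ^ 'n" where
  "commutator A B = A ** B - B ** A"

definition Nil_group :: "(real ^ 3 ^ 3) set" where
  "Nil_group =
     {vector [vector [1, x, z], vector [0, 1, y], vector [0, 0, 1]] | x y z. True}"

definition nil_algebra :: "(real ^ 3 ^ 3) set" where
  "nil_algebra = tangent_at_id Nil_group"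

text \<open>The basis \<open>(X, Y, Z)\<close> is the family \<open>B\<close> of vectors \<open>B $ 1, B $ 2, B $ 3\<close>.\<close>

definition heisenberg_basis :: "(real ^ 3 ^ 3) ^ 3 \<Rightarrow> bool" where
  "heisenberg_basis B \<longleftrightarrow>
     ordered_basis nil_algebra B \<and>
     commutator (B $ 1) (B $ 2) = B $ 3 \<and>
     commutator (B $ 1) (B $ 3) = 0 \<and>
     commutator (B $ 2) (B $ 3) = 0"

abbreviation diag3 :: "real \<Rightarrow> real \<Rightarrow> real \<Rightarrow> real ^ 3 ^ 3" where
  "diag3 a b c \<equiv> vector [vector [a, 0, 0], vector [0, b, 0], vector [0, 0, c]]"

text \<open>Heisenberg bases, and metrics with a prescribed Gram matrix, exist.\<close>

lemma nil_algebra_eq: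
  "nil_algebra = {vector [vector [0, x, z], vector [0, 0, y], vector [0, 0, 0]] | x y z. True}"
    (is "_ = ?R")
proof (intro equalityI subsetI)
  fix A assume "A \<in> nil_algebra"
  then obtain \<gamma> where G: "\<And>t. \<gamma> t \<in> Nil_group"
    and d: "(\<gamma> has_vector_derivative A) (at (0::real))"
    by (auto simp: nil_algebra_def tangent_at_id_def)
  have comp: "((\<lambda>t. \<gamma> t $ i $ j) has_vector_derivative A $ i $ j) (at 0)" for i j
    by (intro bounded_linear.has_vector_derivative[OF bounded_linear_vec_nth] d)
  have const: "A $ i $ j = 0" if "\<And>t. \<gamma> t $ i $ j = k" for i j k
    using comp[of i j] that vector_derivative_unique_at[OF comp[of i j], of 0] by simp
  have "\<exists>x y z. \<gamma> t = vector [vector [1, x, z], vector [0, 1, y], vector [0, 0, 1]]" for t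
    using G[of t] by (auto simp: Nil_group_def)
  then have g: "\<gamma> t $ 1 $ 1 = 1 \<and> \<gamma> t $ 2 $ 1 = 0 \<and> \<gamma> t $ 2 $ 2 = 1 \<and>
    \<gamma> t $ 3 $ 1 = 0 \<and> \<gamma> t $ 3 $ 2 = 0 \<and> \<gamma> t $ 3 $ 3 = 1" for t
    by (metis vector_3)
  have "A = vector [vector [0, A$1$2, A$1$3], vector [0, 0, A$2$3], vector [0, 0, 0]]"
    using const[of 1 1 1] const[of 2 1 0] const[of 2 2 1] const[of 3 1 0] const[of 3 2 0]
      const[of 3 3 1] g
    by (simp add: vec_eq_iff forall_3 vector_3)
  then show "A \<in> ?R" by blast
next
  fix A assume "A \<in> ?R"
  then obtain x y z where A: "A = vector [vector [0, x, z], vector [0, 0, y], vector [0, 0, 0]]"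
    by blast
  define \<gamma> where "\<gamma> t = mat 1 + t *\<^sub>R A" for t :: real
  have "\<gamma> t = vector [vector [1, t*x, t*z], vector [0, 1, t*y], vector [0, 0, 1]]" for t
    by (simp add: \<gamma>_def A vec_eq_iff forall_3 vector_3 mat_def)
  then have "\<gamma> t \<in> Nil_group" for t
    unfolding Nil_group_def by blast
  moreover have "(\<gamma> has_vector_derivative A) (at 0)"
    unfolding \<gamma>_def by (auto intro!: derivative_eq_intros)
  moreover have "\<gamma> 0 = mat 1" by (simp add: \<gamma>_def)
  ultimately show "A \<in> nil_algebra"
    unfolding nil_algebra_def tangent_at_id_def by blast
qed

lemma heisenberg_basis_exists: "\<exists>B. heisenberg_basis B"
proof -
  define X :: "real^3^3" where "X = vector [vector [0,1,0], vector [0,0,0], vector [0,0,0]]"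
  define Y :: "real^3^3" where "Y = vector [vector [0,0,0], vector [0,0,1], vector [0,0,0]]"
  define Z :: "real^3^3" where "Z = vector [vector [0,0,1], vector [0,0,0], vector [0,0,0]]"
  define B :: "(real^3^3)^3" where "B = vector [X, Y, Z]"
  note defs = X_def Y_def Z_def vec_eq_iff forall_3 vector_3
  have ne: "X \<noteq> Y" "X \<noteq> Z" "Y \<noteq> Z" by (auto simp: defs)
  have r: "range (($) B) = {X, Y, Z}"
    by (auto simp: B_def UNIV_3 vector_3)
  have inj: "inj (($) B)"
    using ne by (auto simp: inj_on_def forall_3 B_def vector_3)
  have comb: "a *\<^sub>R X + b *\<^sub>R Y + c *\<^sub>R Z =
      vector [vector [0, a, c], vector [0, 0, b], vector [0, 0, 0]]" for a b c
    by (simp add: defs)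
  have span: "span {X, Y, Z} = nil_algebra"
  proof (intro equalityI subsetI)
    fix A assume "A \<in> span {X, Y, Z}"
    then obtain a b c where "A - a *\<^sub>R X - b *\<^sub>R Y - c *\<^sub>R Z = 0"
      by (auto simp: span_insert)
    then have "A = a *\<^sub>R X + b *\<^sub>R Y + c *\<^sub>R Z" by (simp add: algebra_simps)
    then show "A \<in> nil_algebra" unfolding nil_algebra_eq comb by blast
  next
    fix A assume "A \<in> nil_algebra"
    then obtain a b c where "A = a *\<^sub>R X + b *\<^sub>R Y + c *\<^sub>R Z"
      unfolding nil_algebra_eq comb by blast
    moreover have "X \<in> span {X, Y, Z}" "Y \<in> span {X, Y, Z}" "Z \<in> span {X, Y, Z}"
      by (simp_all add: span_base)
    ultimately show "A \<in> span {X, Y, Z}"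
      by (simp only: span_add span_scale)
  qed
  have ind: "independent {X, Y, Z}"
  proof (rule independent_if_scalars_zero)
    fix f x assume 0: "(\<Sum>x\<in>{X, Y, Z}. f x *\<^sub>R x) = 0" and x: "x \<in> {X, Y, Z}"
    have "f X *\<^sub>R X + f Y *\<^sub>R Y + f Z *\<^sub>R Z = 0"
      using 0 ne by (simp add: add.assoc)
    then have "f X = 0 \<and> f Y = 0 \<and> f Z = 0"
      unfolding comb by (simp add: vec_eq_iff forall_3 vector_3)
    then show "f x = 0" using x by auto
  qed simp
  have "commutator X Y = Z" "commutator X Z = 0" "commutator Y Z = 0"
    by (simp_all add: commutator_def defs matrix_matrix_mult_def sum_3)
  then have "heisenberg_basis B"
    using inj ind span r
    by (simp add: heisenberg_basis_def ordered_basis_def B_def vector_3)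
  then show ?thesis by blast
qed

lemma left_inv_metric_exists:
  fixes B :: "'a::real_vector ^ 'n" and M :: "real ^ 'n ^ 'n"
  assumes B: "ordered_basis g B" and M: "transpose M = M" "invertible M"
  shows "\<exists>ip. left_inv_metric g ip \<and> gram_matrix ip B = M"
proof -
  let ?R = "range (($) B)"
  define co :: "'a \<Rightarrow> real ^ 'n" where "co u = (\<chi> i. representation ?R u (B $ i))" for u
  define ip where "ip u v = co u \<bullet> (M *v co v)" for u v
  have inj: "inj (($) B)" and ind: "independent ?R" and span: "span ?R = g"
    using B by (auto simp: ordered_basis_def)
  have lin: "co (a *\<^sub>R u + b *\<^sub>R v) = a *\<^sub>R co u + b *\<^sub>R co v" if "u \<in> g" "v \<in> g" for a b u v
  proof -
    have "a *\<^sub>R u \<in> span ?R" "b *\<^sub>R v \<in> span ?R" "u \<in> span ?R" "v \<in> span ?R"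
      using that span by (auto intro: span_scale)
    then show ?thesis
      by (simp add: co_def vec_eq_iff representation_add[OF ind] representation_scale[OF ind])
  qed
  have coB: "co (B $ i) = axis i 1" for i
    using inj by (auto simp: co_def vec_eq_iff axis_def representation_basis[OF ind] inj_eq)
  have sym: "ip u v = ip v u" for u v
    by (metis M(1) dot_lmul_matrix inner_commute ip_def transpose_matrix_vector)
  have nondeg: "u = 0" if u: "u \<in> g" and 0: "\<forall>v\<in>g. ip u v = 0" for u
  proof -
    have "ip (B $ i) u = 0" for i
      using 0 sym span by (metis rangeI span_base)
    then have "M *v co u = 0"
      by (simp add: ip_def coB inner_axis' vec_eq_iff)
    then have "co u = 0"
      using M(2) by (metis invertible_def matrix_vector_mul_assoc matrix_vector_mul_lid
          matrix_vector_mult_0_right)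
    then have rep: "representation ?R u b = 0" if "b \<in> ?R" for b
      using that by (auto simp: co_def vec_eq_iff)
    have "(\<Sum>b\<in>?R. representation ?R u b *\<^sub>R b) = u"
      using u span by (intro sum_representation_eq ind) auto
    then show ?thesis using rep by simp
  qed
  have "left_inv_metric g ip"
    unfolding left_inv_metric_def
    using sym nondeg by (auto simp: ip_def lin inner_add_left)
  moreover have "gram_matrix ip B = M"
    by (simp add: gram_matrix_def ip_def coB vec_eq_iff inner_axis' matrix_vector_mult_basis
        column_def)
  ultimately show ?thesis by blast
qed

end

theory Submission
  imports Defs
begin

text \<open>
  In coordinates with respect to the Heisenberg basis the bracket only sees the first two
  components. For a diagonal metric the Koszul identity is solved in closed form, so the curvature
  becomes a polynomial expression and the two traces are read off on the basis vectors. For the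
  metric of (3) the solution has the shape \<open>L\<^sub>u = u\<^sub>2 L\<^sub>Y\<close>, so all operators \<open>L\<^sub>u\<close> commute and
  \<open>L\<close> vanishes on the derived algebra; hence the curvature is zero.
\<close>

section \<open>Coordinates and traces\<close>

text \<open>The coordinate map attached to \<open>B\<close>. It is linear on all of
  \<open>real ^ 'n\<close>, so identities on the algebra become polynomial identities between
  coordinate vectors.\<close>

definition lincomb :: "'a::real_vector ^ 'n \<Rightarrow> real ^ 'n \<Rightarrow> 'a" where
  "lincomb B x = (\<Sum>i\<in>UNIV. x $ i *\<^sub>R B $ i)"

lemma lincomb_add: "lincomb B (x + y) = lincomb B x + lincomb B y"
  by (simp add: lincomb_def scaleR_add_left sum.distrib)

lemma lincomb_scaleR: "lincomb B (a *\<^sub>R x) = a *\<^sub>R lincomb B x"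
  by (simp add: lincomb_def scaleR_right.sum)

lemma lincomb_diff: "lincomb B (x - y) = lincomb B x - lincomb B y"
  by (simp add: lincomb_def scaleR_diff_left sum_subtractf)

lemma lincomb_zero [simp]: "lincomb B 0 = 0"
  by (simp add: lincomb_def)

lemma lincomb_axis [simp]: "lincomb B (axis i 1) = B $ i"
proof -
  have "lincomb B (axis i 1) = (\<Sum>j\<in>UNIV. if j = i then B $ j else 0)"
    unfolding lincomb_def by (rule sum.cong) (auto simp: axis_def)
  then show ?thesis by simp
qed

lemma lincomb_mem: "ordered_basis g B \<Longrightarrow> lincomb B x \<in> g"
  unfolding ordered_basis_def lincomb_def
  by (metis (no_types, lifting) span_sum span_scale span_base rangeI)

lemma ordered_basis_lincomb:
  assumes "ordered_basis g B"
  shows "g = range (lincomb B)"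
proof (intro equalityI subsetI)
  fix u assume "u \<in> g"
  then have u: "u \<in> span (range (($) B))" and inj: "inj (($) B)"
    and ind: "independent (range (($) B))"
    using assms by (auto simp: ordered_basis_def)
  let ?r = "representation (range (($) B)) u"
  have "u = (\<Sum>b\<in>range (($) B). ?r b *\<^sub>R b)"
    using sum_representation_eq[OF ind u, of "range (($) B)"] by simp
  also have "\<dots> = lincomb B (\<chi> i. ?r (B $ i))"
    using inj by (simp add: sum.reindex lincomb_def)
  finally show "u \<in> range (lincomb B)" by blast
qed (use lincomb_mem[OF assms] in auto)

lemma representation_lincomb:
  assumes "ordered_basis g B"
  shows "representation (range (($) B)) (lincomb B x) (B $ i) = x $ i"
proof -
  have inj: "inj (($) B)" and ind: "independent (range (($) B))"
    using assms by (auto simp: ordered_basis_def)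
  have "representation (range (($) B)) (lincomb B x) (B $ i)
      = (\<Sum>j\<in>UNIV. x $ j * (if j = i then 1 else 0))"
    unfolding lincomb_def using inj
    by (simp add: representation_sum[OF ind] representation_scale[OF ind]
        representation_basis[OF ind] span_scale span_base inj_eq eq_commute)
  then show ?thesis by (simp add: if_distrib cong: if_cong)
qed

text \<open>Expanding each \<open>b\<close> in \<open>C\<close> on the left and each
  \<open>f c\<close> in \<open>B\<close> on the right turns both sides into the double sum of
  \<open>representation C b c * representation B (f c) b\<close>. Linearity is stated relative to
  \<open>V\<close>, since operators such as the curvature are meaningful only on the
  algebra.\<close>

lemma sum_representation_basis_change:
  fixes f :: "'a::real_vector \<Rightarrow> 'a"
  assumes ind: "independent B" "independent C"
    and span: "span B = V" "span C = V"
    and fin: "finite B" "finite C"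
    and V: "\<And>u. u \<in> V \<Longrightarrow> f u \<in> V"
    and add: "\<And>u v. u \<in> V \<Longrightarrow> v \<in> V \<Longrightarrow> f (u + v) = f u + f v"
    and scale: "\<And>a u. u \<in> V \<Longrightarrow> f (a *\<^sub>R u) = a *\<^sub>R f u"
  shows "(\<Sum>b\<in>B. representation B (f b) b) = (\<Sum>c\<in>C. representation C (f c) c)"
proof -
  have BV: "b \<in> V" if "b \<in> B" for b using that span(1) span_base by auto
  have CV: "c \<in> V" if "c \<in> C" for c using that span(2) span_base by auto
  have zero: "f 0 = 0" using scale[of 0 0] span span_zero by auto
  have fsum: "f (\<Sum>c\<in>S. k c *\<^sub>R c) = (\<Sum>c\<in>S. k c *\<^sub>R f c)" if "finite S" "S \<subseteq> V" for S k
    using that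
  proof (induction S)
    case (insert c S)
    have "k c *\<^sub>R c \<in> V" "(\<Sum>c\<in>S. k c *\<^sub>R c) \<in> V"
      using insert.prems span(1) by (auto intro!: span_sum span_scale)
    then show ?case using insert by (simp add: add scale)
  qed (simp add: zero)
  have rep: "(\<Sum>b\<in>B. representation B u b *\<^sub>R b) = u"
    "(\<Sum>c\<in>C. representation C u c *\<^sub>R c) = u" if "u \<in> V" for u
    using that ind span fin by (auto intro: sum_representation_eq)
  have "(\<Sum>b\<in>B. representation B (f b) b)
      = (\<Sum>b\<in>B. \<Sum>c\<in>C. representation C b c * representation B (f c) b)"
  proof (rule sum.cong)
    fix b assume "b \<in> B"
    have "f b = (\<Sum>c\<in>C. representation C b c *\<^sub>R f c)"
      using fsum[OF fin(2), of "representation C b"] rep(2)[OF BV[OF \<open>b \<in> B\<close>]] CV by auto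
    moreover have "f c \<in> span B" if "c \<in> C" for c
      using that span(1) V CV by simp
    then have "representation B (\<Sum>c\<in>C. representation C b c *\<^sub>R f c) b
        = (\<Sum>c\<in>C. representation C b c * representation B (f c) b)"
      by (simp add: representation_sum[OF ind(1)] representation_scale[OF ind(1)] span_scale)
    ultimately show "representation B (f b) b
        = (\<Sum>c\<in>C. representation C b c * representation B (f c) b)" by simp
  qed simp
  also have "\<dots> = (\<Sum>c\<in>C. \<Sum>b\<in>B. representation B (f c) b * representation C b c)"
    by (subst sum.swap) (simp add: mult.commute)
  also have "\<dots> = (\<Sum>c\<in>C. representation C (f c) c)"
  proof (rule sum.cong)
    fix c assume "c \<in> C"
    have "representation C (f c) c
        = representation C (\<Sum>b\<in>B. representation B (f c) b *\<^sub>R b) c"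
      using rep(1) V CV \<open>c \<in> C\<close> by simp
    also have "\<dots> = (\<Sum>b\<in>B. representation B (f c) b * representation C b c)"
    proof -
      have "b \<in> span C" if "b \<in> B" for b
        using that span(2) BV by simp
      then show ?thesis
        by (simp add: representation_sum[OF ind(2)] representation_scale[OF ind(2)] span_scale)
    qed
    finally show "(\<Sum>b\<in>B. representation B (f c) b * representation C b c)
        = representation C (f c) c" by simp
  qed simp
  finally show ?thesis .
qed

text \<open>The basis inside \<open>trace_on\<close> is an arbitrary choice; basis independence
  replaces it by \<open>B\<close>, where the diagonal coefficients of \<open>f\<close> are those of
  its coordinate form \<open>h\<close>.\<close>

lemma trace_on_lincomb:
  fixes B :: "'a::real_vector ^ 'n"
  assumes B: "ordered_basis V B" and h: "linear h"
    and f: "\<And>x. f (lincomb B x) = lincomb B (h x)"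
  shows "trace_on V f = (\<Sum>i\<in>UNIV. h (axis i 1) $ i)"
proof -
  let ?R = "range (($) B)"
  have inj: "inj (($) B)" and ind: "independent ?R" and span: "span ?R = V"
    using B by (auto simp: ordered_basis_def)
  define C where "C = (SOME C. independent C \<and> span C = V)"
  have "independent C \<and> span C = V"
    unfolding C_def by (rule someI[of _ ?R]) (use ind span in simp)
  \<comment> \<open>The chosen basis is finite because it is independent and lies in the span of the
    finite set \<open>?R\<close>.\<close>
  moreover from this have "finite C"
    using independent_span_bound[of ?R C] span span_superset by fastforce
  ultimately have "trace_on V f = (\<Sum>b\<in>?R. representation ?R (f b) b)"
    unfolding trace_on_def Let_def C_def[symmetric]
  proof (intro sum_representation_basis_change)
    fix u v and a :: real
    show "u \<in> V \<Longrightarrow> f u \<in> V"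
      using ordered_basis_lincomb[OF B] f by auto
    show "u \<in> V \<Longrightarrow> v \<in> V \<Longrightarrow> f (u + v) = f u + f v"
      using ordered_basis_lincomb[OF B] f
      by (auto simp: lincomb_add[symmetric] linear_add[OF h])
    show "u \<in> V \<Longrightarrow> f (a *\<^sub>R u) = a *\<^sub>R f u"
      using ordered_basis_lincomb[OF B] f
      by (auto simp: lincomb_scaleR[symmetric] linear_scale[OF h])
  qed (use ind span in auto)
  also have "\<dots> = (\<Sum>i\<in>UNIV. representation ?R (f (B $ i)) (B $ i))"
    using inj by (simp add: sum.reindex)
  also have "\<dots> = (\<Sum>i\<in>UNIV. h (axis i 1) $ i)"
    using f[of "axis _ 1"] by (simp add: representation_lincomb[OF B])
  finally show ?thesis .
qed

section \<open>Metrics in coordinates\<close>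

lemma left_inv_metric_linear:
  assumes "left_inv_metric g ip" "u \<in> g" "v \<in> g" "w \<in> g"
  shows "ip (a *\<^sub>R u + b *\<^sub>R v) w = a * ip u w + b * ip v w"
  using assms unfolding left_inv_metric_def by simp

lemma left_inv_metric_sum:
  assumes ip: "left_inv_metric g ip" and g: "subspace g" and "finite S"
    and "\<And>i. i \<in> S \<Longrightarrow> b i \<in> g" and "w \<in> g"
  shows "ip (\<Sum>i\<in>S. k i *\<^sub>R b i) w = (\<Sum>i\<in>S. k i * ip (b i) w)"
  using \<open>finite S\<close> assms(4)
proof (induction S)
  case empty
  \<comment> \<open>Taking both coefficients 0 in the linearity law gives
    \<open>ip 0 w = 0\<close>.\<close>
  show ?case
    using left_inv_metric_linear[OF ip \<open>w \<in> g\<close> \<open>w \<in> g\<close> \<open>w \<in> g\<close>, of 0 0] by simp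
next
  case (insert j S)
  have "(\<Sum>i\<in>S. k i *\<^sub>R b i) \<in> g"
    using insert.prems g by (auto intro: subspace_sum subspace_scale)
  then have "ip (k j *\<^sub>R b j + 1 *\<^sub>R (\<Sum>i\<in>S. k i *\<^sub>R b i)) w
      = k j * ip (b j) w + 1 * ip (\<Sum>i\<in>S. k i *\<^sub>R b i) w"
    using insert.prems \<open>w \<in> g\<close> by (intro left_inv_metric_linear[OF ip]) auto
  then show ?case using insert by simp
qed

lemma left_inv_metric_lincomb:
  fixes B :: "'a::real_vector ^ 'n"
  assumes ip: "left_inv_metric g ip" and B: "ordered_basis g B"
  shows "ip (lincomb B x) (lincomb B y)
    = (\<Sum>i\<in>UNIV. \<Sum>j\<in>UNIV. x $ i * y $ j * gram_matrix ip B $ i $ j)"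
proof -
  have g: "subspace g" using B unfolding ordered_basis_def by (metis subspace_span)
  have mem: "B $ i \<in> g" for i using lincomb_mem[OF B, of "axis i 1"] by simp
  have sym: "ip u v = ip v u" if "u \<in> g" "v \<in> g" for u v
    using ip that unfolding left_inv_metric_def by blast
  have "ip (lincomb B x) (lincomb B y) = (\<Sum>i\<in>UNIV. x $ i * ip (B $ i) (lincomb B y))"
    by (subst (1) lincomb_def) (simp add: left_inv_metric_sum[OF ip g] mem lincomb_mem[OF B])
  \<comment> \<open>Linearity is available in the first argument, so symmetry moves the second
    combination there.\<close>
  also have "\<dots> = (\<Sum>i\<in>UNIV. x $ i * ip (lincomb B y) (B $ i))"
    using sym mem lincomb_mem[OF B] by simp
  also have "\<dots> = (\<Sum>i\<in>UNIV. \<Sum>j\<in>UNIV. x $ i * (y $ j * ip (B $ j) (B $ i)))"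
    by (simp add: lincomb_def left_inv_metric_sum[OF ip g] mem sum_distrib_left)
  also have "\<dots> = (\<Sum>i\<in>UNIV. \<Sum>j\<in>UNIV. x $ i * y $ j * gram_matrix ip B $ i $ j)"
    using sym mem by (simp add: gram_matrix_def mult.assoc)
  finally show ?thesis .
qed

text \<open>Nondegeneracy applied to \<open>x - y\<close>. This is the uniqueness behind both
  definite descriptions, \<open>levi_civita\<close> and \<open>ricci_operator\<close>.\<close>

lemma left_inv_metric_cancel:
  assumes ip: "left_inv_metric g ip" and "subspace g" and "x \<in> g" "y \<in> g"
    and eq: "\<And>w. w \<in> g \<Longrightarrow> ip x w = ip y w"
  shows "x = y"
proof -
  have "ip (1 *\<^sub>R x + (- 1) *\<^sub>R y) w = 1 * ip x w + (- 1) * ip y w" if "w \<in> g" for w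
    by (rule left_inv_metric_linear[OF ip \<open>x \<in> g\<close> \<open>y \<in> g\<close> that])
  then have "ip (x - y) w = 0" if "w \<in> g" for w using that eq by simp
  moreover have "x - y \<in> g" using assms by (auto intro: subspace_diff)
  ultimately have "x - y = 0" using ip unfolding left_inv_metric_def by blast
  then show ?thesis by simp
qed

text \<open>The vector \<open>z\<close> gives existence and nondegeneracy gives uniqueness, so
  evaluating the definite description amounts to checking the Koszul identity in
  coordinates.\<close>

lemma levi_civita_lincomb:
  assumes ip: "left_inv_metric g ip" and B: "ordered_basis g B"
    and z: "\<And>w. 2 * ip (lincomb B z) (lincomb B w)
      = ip (br u v) (lincomb B w) + ip (br (lincomb B w) u) v + ip (br (lincomb B w) v) u"
  shows "levi_civita g br ip u v = lincomb B z"
proof -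
  have g: "subspace g" using B unfolding ordered_basis_def by (metis subspace_span)
  show ?thesis
    unfolding levi_civita_def
  proof (rule the_equality)
    show "lincomb B z \<in> g \<and> (\<forall>w\<in>g. 2 * ip (lincomb B z) w
        = ip (br u v) w + ip (br w u) v + ip (br w v) u)"
      using z ordered_basis_lincomb[OF B] by auto
  next
    fix x assume x: "x \<in> g \<and>
      (\<forall>w\<in>g. 2 * ip x w = ip (br u v) w + ip (br w u) v + ip (br w v) u)"
    show "x = lincomb B z"
    proof (rule left_inv_metric_cancel[OF ip g])
      fix w assume w: "w \<in> g"
      then obtain w' where "w = lincomb B w'" using ordered_basis_lincomb[OF B] by auto
      then have "2 * ip x w = 2 * ip (lincomb B z) w" using x w z by simp
      then show "ip x w = ip (lincomb B z) w" by simp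
    qed (use x lincomb_mem[OF B] in auto)
  qed
qed

lemma ricci_operator_lincomb:
  assumes ip: "left_inv_metric g ip" and B: "ordered_basis g B"
    and z: "\<And>w. ip (lincomb B z) (lincomb B w) = ric g br ip u (lincomb B w)"
  shows "ricci_operator g br ip u = lincomb B z"
proof -
  have g: "subspace g" using B unfolding ordered_basis_def by (metis subspace_span)
  have 1: "lincomb B z \<in> g \<and> (\<forall>v\<in>g. ip (lincomb B z) v = ric g br ip u v)"
    using z ordered_basis_lincomb[OF B] by auto
  show ?thesis
    unfolding ricci_operator_def
    by (rule the_equality, rule 1, rule left_inv_metric_cancel[OF ip g]) (use 1 in auto)
qed

section \<open>The Heisenberg algebra\<close>

text \<open>Bilinear expansion: only the brackets of \<open>B $ 1\<close> with \<open>B $ 2\<close>,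
  in either order, survive, and together they contribute a 2 by 2 determinant times
  \<open>B $ 3\<close>.\<close>

lemma commutator_lincomb:
  assumes "heisenberg_basis B"
  shows "commutator (lincomb B x) (lincomb B y)
    = lincomb B (vector [0, 0, x $ 1 * y $ 2 - x $ 2 * y $ 1])"
proof -
  have add: "commutator (a + b) c = commutator a c + commutator b c"
    "commutator c (a + b) = commutator c a + commutator c b"
    and scale: "commutator (k *\<^sub>R a) b = k *\<^sub>R commutator a b"
    "commutator a (k *\<^sub>R b) = k *\<^sub>R commutator a b"
    and anti: "commutator b a = - commutator a b" "commutator a a = 0"
    for a b c :: "real ^ 3 ^ 3" and k
    by (simp_all add: commutator_def matrix_matrix_mult_def vec_eq_iff sum_3 algebra_simps)
  have B: "commutator (B $ 1) (B $ 2) = B $ 3" "commutator (B $ 1) (B $ 3) = 0"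
    "commutator (B $ 2) (B $ 3) = 0"
    using assms by (auto simp: heisenberg_basis_def)
  then have B': "commutator (B $ 2) (B $ 1) = - B $ 3" "commutator (B $ 3) (B $ 1) = 0"
    "commutator (B $ 3) (B $ 2) = 0"
    using anti(1)[of "B $ 2" "B $ 1"] anti(1)[of "B $ 3" "B $ 1"] anti(1)[of "B $ 3" "B $ 2"]
    by auto
  show ?thesis
    by (simp add: lincomb_def sum_3 add scale anti(2) B B' algebra_simps)
qed

lemma flat_heisenberg:
  assumes B: "heisenberg_basis B" and ip: "left_inv_metric nil_algebra ip"
    and G: "gram_matrix ip B = vector [vector [1, 0, 0], vector [0, 1, 1/2], vector [0, 1/2, 0]]"
  shows "flat nil_algebra commutator ip"
proof -
  have ob: "ordered_basis nil_algebra B" using B by (simp add: heisenberg_basis_def)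
  \<comment> \<open>The right side of the Koszul identity is
    \<open>x$2 * y$2 * w$1 - x$2 * y$1 * w$2\<close>. As \<open>w$3\<close> is absent, the second
    coordinate of the product is 0; the coefficients of \<open>w$1\<close> and \<open>w$2\<close>
    then give the other two.\<close>
  have L: "levi_civita nil_algebra commutator ip (lincomb B x) (lincomb B y)
      = lincomb B (vector [x $ 2 * y $ 2 / 2, 0, - (x $ 2 * y $ 1)])" for x y
    by (rule levi_civita_lincomb[OF ip ob])
      (simp add: commutator_lincomb[OF B] left_inv_metric_lincomb[OF ip ob] G sum_3 field_simps)
  \<comment> \<open>A bracket has second coordinate 0, which kills the first curvature term. The
    iterated product of \<open>x\<close>, \<open>y\<close>, \<open>z\<close> has the single
    coordinate \<open>- (x$2 * y$2 * z$2) / 2\<close> along \<open>B $ 3\<close>, symmetric in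
    \<open>x\<close> and \<open>y\<close>, so the other two terms cancel.\<close>
  have "curvature nil_algebra commutator ip (lincomb B x) (lincomb B y) (lincomb B z) = 0"
    for x y z
    by (simp add: curvature_def commutator_lincomb[OF B] L)
      (simp add: lincomb_def sum_3)
  then show ?thesis
    unfolding flat_def by (metis ordered_basis_lincomb[OF ob] rangeE)
qed

section \<open>Curvature of diagonal metrics on the Heisenberg algebra\<close>

locale diagonal_heisenberg =
  fixes B :: "(real ^ 3 ^ 3) ^ 3" and ip p q r
  assumes B: "heisenberg_basis B" and ip: "left_inv_metric nil_algebra ip"
    and G: "gram_matrix ip B = diag3 p q r"
    and nz: "p \<noteq> 0" "q \<noteq> 0"
begin

lemma ob: "ordered_basis nil_algebra B"
  using B by (simp add: heisenberg_basis_def)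

text \<open>For a diagonal Gram matrix, each coordinate of the product is the matching coefficient
  of \<open>w\<close> in the Koszul identity, divided by \<open>2*p\<close>, \<open>2*q\<close> or
  \<open>2*r\<close>. In the third one the factor \<open>r\<close> cancels, because that coefficient
  is itself a multiple of \<open>r\<close>.\<close>

lemma levi_civita_diag:
  "levi_civita nil_algebra commutator ip (lincomb B x) (lincomb B y)
    = lincomb B (vector [r / (2*p) * (x$2 * y$3 + x$3 * y$2),
        - r / (2*q) * (x$1 * y$3 + x$3 * y$1), (x$1 * y$2 - x$2 * y$1) / 2])"
    (is "_ = lincomb B ?z")
proof (rule levi_civita_lincomb[OF ip ob])
  fix w
  \<comment> \<open>Denominators are cleared first, so that both sides of the Koszul identity can be
    compared as polynomials.\<close>
  have "2 * (?z $ 1 * p) = r * (x$2 * y$3 + x$3 * y$2)"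
    "2 * (?z $ 2 * q) = - r * (x$1 * y$3 + x$3 * y$1)"
    "2 * (?z $ 3 * r) = r * (x$1 * y$2 - x$2 * y$1)"
    using nz by simp_all
  moreover have "2 * ip (lincomb B ?z) (lincomb B w)
      = 2 * (?z $ 1 * p) * w$1 + 2 * (?z $ 2 * q) * w$2 + 2 * (?z $ 3 * r) * w$3"
    by (simp only: left_inv_metric_lincomb[OF ip ob] G sum_3) simp
  ultimately have "2 * ip (lincomb B ?z) (lincomb B w)
      = r * (x$2 * y$3 + x$3 * y$2) * w$1 - r * (x$1 * y$3 + x$3 * y$1) * w$2
        + r * (x$1 * y$2 - x$2 * y$1) * w$3"
    by simp
  then show "2 * ip (lincomb B ?z) (lincomb B w)
      = ip (commutator (lincomb B x) (lincomb B y)) (lincomb B w)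
        + ip (commutator (lincomb B w) (lincomb B x)) (lincomb B y)
        + ip (commutator (lincomb B w) (lincomb B y)) (lincomb B x)"
    by (simp add: commutator_lincomb[OF B] left_inv_metric_lincomb[OF ip ob] G sum_3 algebra_simps)
qed

lemma ric_diag:
  "ric nil_algebra commutator ip (lincomb B x) (lincomb B y)
    = - r / (2*q) * x$1 * y$1 - r / (2*p) * x$2 * y$2 + r\<^sup>2 / (2*p*q) * x$3 * y$3"
proof -
  \<comment> \<open>In coordinates, \<open>l\<close> is the Levi-Civita product and \<open>h\<close>
    is the operator sending \<open>w\<close> to K(x,w)y, whose trace is the Ricci tensor.\<close>
  define l :: "real^3 \<Rightarrow> real^3 \<Rightarrow> real^3" where
    "l x y = vector [r / (2*p) * (x$2 * y$3 + x$3 * y$2),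
        - r / (2*q) * (x$1 * y$3 + x$3 * y$1), (x$1 * y$2 - x$2 * y$1) / 2]" for x y
  define h where
    "h w = l (vector [0, 0, x$1 * w$2 - x$2 * w$1]) y - (l x (l w y) - l w (l x y))" for w
  have "curvature nil_algebra commutator ip (lincomb B x) (lincomb B w) (lincomb B y)
      = lincomb B (h w)" for w
    by (simp add: curvature_def commutator_lincomb[OF B] levi_civita_diag h_def l_def lincomb_diff)
  moreover have "linear h"
    by (rule linearI)
      (simp_all add: h_def l_def vec_eq_iff forall_3 algebra_simps add_divide_distrib
        diff_divide_distrib)
  ultimately have "ric nil_algebra commutator ip (lincomb B x) (lincomb B y)
      = (\<Sum>i\<in>UNIV. h (axis i 1) $ i)"
    unfolding ric_def by (intro trace_on_lincomb[OF ob])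
  also have "\<dots> = - r / (2*q) * x$1 * y$1 - r / (2*p) * x$2 * y$2 + r\<^sup>2 / (2*p*q) * x$3 * y$3"
    using nz by (simp add: sum_3 h_def l_def axis_def field_simps power2_eq_square)
  finally show ?thesis .
qed

lemma gram_matrix_ric:
  "gram_matrix (ric nil_algebra commutator ip) B
    = (1/2) *\<^sub>R diag3 (- r / q) (- r / p) (r\<^sup>2 / (p * q))"
proof -
  have "ric nil_algebra commutator ip (B $ i) (B $ j) =
      - r / (2*q) * axis i 1 $ 1 * axis j 1 $ 1 - r / (2*p) * axis i 1 $ 2 * axis j 1 $ 2
      + r\<^sup>2 / (2*p*q) * axis i 1 $ 3 * axis j 1 $ 3" for i j
    using ric_diag[of "axis i 1" "axis j 1"] unfolding lincomb_axis .
  then show ?thesis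
    by (simp add: gram_matrix_def vec_eq_iff forall_3 axis_def)
qed

lemma scalar_curvature_diag: "scalar_curvature nil_algebra commutator ip = - r / (2*p*q)"
proof -
  \<comment> \<open>The Ricci operator is the inverse Gram matrix times the Ricci matrix. Dividing
    the diagonal Ricci entries by \<open>p\<close>, \<open>q\<close>, \<open>r\<close> gives the
    common factor \<open>r / (2*p*q)\<close> with signs -, -, +, hence the trace
    \<open>- r / (2*p*q)\<close>.\<close>
  define h :: "real^3 \<Rightarrow> real^3" where
    "h x = (r / (2*p*q)) *\<^sub>R vector [- x$1, - x$2, x$3]" for x
  have "ricci_operator nil_algebra commutator ip (lincomb B x) = lincomb B (h x)" for x
  proof (rule ricci_operator_lincomb[OF ip ob])
    fix w
    have "h x $ 1 * p = - r / (2*q) * x$1" "h x $ 2 * q = - r / (2*p) * x$2"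
      "h x $ 3 * r = r\<^sup>2 / (2*p*q) * x$3"
      using nz by (simp_all add: h_def power2_eq_square)
    moreover have "ip (lincomb B (h x)) (lincomb B w)
        = (h x $ 1 * p) * w$1 + (h x $ 2 * q) * w$2 + (h x $ 3 * r) * w$3"
      by (simp add: left_inv_metric_lincomb[OF ip ob] G sum_3)
    ultimately show "ip (lincomb B (h x)) (lincomb B w)
        = ric nil_algebra commutator ip (lincomb B x) (lincomb B w)"
      by (simp add: ric_diag)
  qed
  moreover have "linear h"
    by (rule linearI) (simp_all add: h_def vec_eq_iff forall_3 algebra_simps diff_divide_distrib
        add_divide_distrib)
  ultimately have "scalar_curvature nil_algebra commutator ip = (\<Sum>i\<in>UNIV. h (axis i 1) $ i)"
    unfolding scalar_curvature_def by (intro trace_on_lincomb[OF ob])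
  then show ?thesis by (simp add: sum_3 h_def axis_def)
qed

text \<open>The Ricci form is diagonal with coefficients \<open>- r / (2*q)\<close>,
  \<open>- r / (2*p)\<close> and \<open>r\<^sup>2 / (2*p*q)\<close>. The first two are positive
  because \<open>r\<close> is negative; in the third \<open>r\<close> enters squared, so
  \<open>ric\<close> is positive even along the direction \<open>B $ 3\<close> where the metric is
  negative.\<close>

lemma positive_definite_ric:
  assumes "p > 0" "q > 0" "r < 0"
  shows "positive_definite_on nil_algebra (ric nil_algebra commutator ip)"
  unfolding positive_definite_on_def
proof (intro ballI impI)
  fix u assume "u \<in> nil_algebra" "u \<noteq> 0"
  then obtain x where x: "u = lincomb B x" and "x \<noteq> 0"
    by (metis ordered_basis_lincomb[OF ob] rangeE lincomb_zero)
  define a b c where "a = - r / (2*q)" and "b = - r / (2*p)" and "c = r\<^sup>2 / (2*p*q)"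
  have pos: "a > 0" "b > 0" "c > 0"
    using assms by (auto simp: a_def b_def c_def divide_neg_pos)
  have ric: "ric nil_algebra commutator ip u u = a * (x$1)\<^sup>2 + b * (x$2)\<^sup>2 + c * (x$3)\<^sup>2"
    by (simp add: x ric_diag a_def b_def c_def power2_eq_square)
  have "x$1 \<noteq> 0 \<or> x$2 \<noteq> 0 \<or> x$3 \<noteq> 0"
    using \<open>x \<noteq> 0\<close> by (simp add: vec_eq_iff forall_3)
  moreover have "a * (x$1)\<^sup>2 \<ge> 0" "b * (x$2)\<^sup>2 \<ge> 0" "c * (x$3)\<^sup>2 \<ge> 0"
    using pos by simp_all
  moreover have "y \<noteq> 0 \<Longrightarrow> a * y\<^sup>2 > 0" "y \<noteq> 0 \<Longrightarrow> b * y\<^sup>2 > 0" "y \<noteq> 0 \<Longrightarrow> c * y\<^sup>2 > 0" for y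
    using pos by simp_all
  ultimately show "ric nil_algebra commutator ip u u > 0"
    unfolding ric by (smt (verit))
qed

end

theorem proposition4p1:
  fixes B0 :: "(real ^ 3 ^ 3) ^ 3"
  assumes "heisenberg_basis B0"
  shows
    "(\<forall>c ip. c > 0 \<and> left_inv_metric nil_algebra ip \<and> gram_matrix ip B0 = diag3 1 1 (- c) \<longrightarrow>
       gram_matrix (ric nil_algebra commutator ip) B0 = (1/2) *\<^sub>R diag3 c c (c\<^sup>2) \<and>
       scalar_curvature nil_algebra commutator ip = 1/2 * c \<and>
       positive_definite_on nil_algebra (ric nil_algebra commutator ip) \<and>
       scalar_curvature nil_algebra commutator ip > 0)
     \<and>
     (\<forall>c ip. c > 0 \<and> left_inv_metric nil_algebra ip \<and> gram_matrix ip B0 = diag3 c 1 (- 1) \<longrightarrow>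
       gram_matrix (ric nil_algebra commutator ip) B0 = (1/2) *\<^sub>R diag3 1 (1/c) (1/c) \<and>
       scalar_curvature nil_algebra commutator ip = 1 / (2 * c) \<and>
       positive_definite_on nil_algebra (ric nil_algebra commutator ip) \<and>
       scalar_curvature nil_algebra commutator ip > 0)
     \<and>
     (\<forall>ip. left_inv_metric nil_algebra ip \<and>
       gram_matrix ip B0 = vector [vector [1, 0, 0], vector [0, 1, 1/2], vector [0, 1/2, 0]] \<longrightarrow>
       flat nil_algebra commutator ip)"
proof (rule conjI[OF _ conjI]; intro allI impI)
  fix c :: real and ip
  assume a: "c > 0 \<and> left_inv_metric nil_algebra ip \<and> gram_matrix ip B0 = diag3 1 1 (- c)"
  \<comment> \<open>Here \<open>- r / q\<close> and \<open>- r / p\<close> are both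
    \<open>c\<close>, and \<open>r\<^sup>2 / (p * q)\<close> is \<open>c\<^sup>2\<close>.\<close>
  then interpret diagonal_heisenberg B0 ip 1 1 "- c"
    using assms by unfold_locales auto
  show "gram_matrix (ric nil_algebra commutator ip) B0 = (1/2) *\<^sub>R diag3 c c (c\<^sup>2) \<and>
       scalar_curvature nil_algebra commutator ip = 1/2 * c \<and>
       positive_definite_on nil_algebra (ric nil_algebra commutator ip) \<and>
       scalar_curvature nil_algebra commutator ip > 0"
    using a by (simp add: gram_matrix_ric scalar_curvature_diag positive_definite_ric)
next
  fix c :: real and ip
  assume a: "c > 0 \<and> left_inv_metric nil_algebra ip \<and> gram_matrix ip B0 = diag3 c 1 (- 1)"
  \<comment> \<open>Now \<open>- r / q\<close> is 1, while \<open>- r / p\<close> and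
    \<open>r\<^sup>2 / (p * q)\<close> are both \<open>1/c\<close>.\<close>
  then interpret diagonal_heisenberg B0 ip c 1 "- 1"
    using assms by unfold_locales auto
  show "gram_matrix (ric nil_algebra commutator ip) B0 = (1/2) *\<^sub>R diag3 1 (1/c) (1/c) \<and>
       scalar_curvature nil_algebra commutator ip = 1 / (2 * c) \<and>
       positive_definite_on nil_algebra (ric nil_algebra commutator ip) \<and>
       scalar_curvature nil_algebra commutator ip > 0"
    using a by (simp add: gram_matrix_ric scalar_curvature_diag positive_definite_ric)
next
  fix ip
  assume "left_inv_metric nil_algebra ip \<and>
       gram_matrix ip B0 = vector [vector [1, 0, 0], vector [0, 1, 1/2], vector [0, 1/2, 0]]"
  then show "flat nil_algebra commutator ip"
    using flat_heisenberg[OF assms] by blast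
qed

end
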